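(* Let $m\in\{1,2,3\}$, let $\mathbf{a}\in\mathbb{C}^m$ be the vector of anchor positions, let $r_1,\dots,r_m$ be real range measurements, and let $\mathbf{c}\in\mathbb{C}^m$, $\mathbf{r}\in\mathbb{R}^m$ and the sets $\mathcal{S},\mathcal{T}\subset\mathbb{R}^2$ be as defined in the context. Then $\mathcal{S}$ and $\mathcal{T}$ have the same set of supporting hyperplanes with nonnegative normal elements; that is, for every $\beta\in[0,\pi/2]$, $$\max_{(u,v)\in\mathcal{S}}\big(u\cos\beta+v\sin\beta\big)=\max_{(u,v)\in\mathcal{T}}\big(u\cos\beta+v\sin\beta\big).$$ Equivalently, in the relevant portion of its boundary, $\mathcal{T}$ coincides with the convex hull of $\mathcal{S}$: the set of points of $\mathcal{T}$ lying on some supporting hyperplane of $\mathcal{T}$ with nonnegative normal elements equals the set of points of $\mathrm{co}(\mathcal{S})$ lying on some supporting hyperplane of $\mathrm{co}(\mathcal{S})$ with nonnegative normal elements.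
   Context: Source localization in the plane with $m$ anchors: anchor positions are written as complex numbers and collected in $\mathbf{a}=[a_1,\dots,a_m]^T\in\mathbb{C}^m$, and $r_1,\dots,r_m$ are the measured ranges. Set $\mathbf{R}=\mathrm{diag}(r_1,\dots,r_m)$, let $\mathbf{1}_m$ be the vector of $m$ ones and $\mathbf{I}_m$ the identity matrix, and define $$\mathbf{r}=\mathbf{R}\mathbf{1}_m,\qquad \mathbf{c}=\mathbf{R}\big(\mathbf{I}_m-\tfrac1m\mathbf{1}_m\mathbf{1}_m^T\big)\mathbf{a}.$$ With $^H$ denoting conjugate transpose, define $$\mathcal{S}=\big\{(|\mathbf{c}^H\boldsymbol{\theta}|^2,\ |\mathbf{r}^T\boldsymbol{\theta}|^2):\ \boldsymbol{\theta}\in\mathbb{C}^m,\ |\theta_i|=1\ \text{for all } i\big\},$$ $$\mathcal{T}=\big\{(\mathrm{tr}(\mathbf{c}\mathbf{c}^H\boldsymbol{\Phi}),\ \mathrm{tr}(\mathbf{r}\mathbf{r}^T\boldsymbol{\Phi})):\ \boldsymbol{\Phi}\in\mathbb{C}^{m\times m},\ \boldsymbol{\Phi}\succeq 0,\ \phi_{ii}=1\ \text{for all } i\big\},$$ where $\boldsymbol{\Phi}\succeq0$ means Hermitian positive semidefinite. $\mathrm{co}(\cdot)$ denotes the convex hull. For a compact set $K\subset\mathbb{R}^2$ and $\beta\in[0,\pi/2]$, the supporting hyperplane of $K$ with (outward) normal $(\cos\beta,\sin\beta)$ is the line $\{w\in\mathbb{R}^2:\langle(\cos\beta,\sin\beta),w\rangle=\max_{w'\in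 K}\langle(\cos\beta,\sin\beta),w'\rangle\}$; these are the supporting hyperplanes "with nonnegative normal elements". The "relevant portion" of the boundary is the portion touched by such supporting hyperplanes. *)

theory Defs
  imports "HOL-Analysis.Analysis"
begin

definition cnj_vec :: "complex^'m \<Rightarrow> complex^'m" where
  "cnj_vec x = (\<chi> i. cnj (x $ i))"

definition outer_prod :: "complex^'m \<Rightarrow> complex^'m \<Rightarrow> complex^'m^'m" where
  "outer_prod x y = (\<chi> i j. x $ i * y $ j)"

definition hermitian_psd :: "complex^'m^'m \<Rightarrow> bool" where
  "hermitian_psd A \<longleftrightarrow>
     map_matrix cnj (transpose A) = A \<and>
     (\<forall>x. 0 \<le> Re (scalar_product (cnj_vec x) (A *v x)))"

definition range_mat :: "real^'m \<Rightarrow> complex^'m^'m" where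
  "range_mat \<rho> = (\<chi> i j. if i = j then complex_of_real (\<rho> $ i) else 0)"

definition range_vec :: "real^'m \<Rightarrow> complex^'m" where
  "range_vec \<rho> = range_mat \<rho> *v vec 1"

definition center_vec :: "real^'m \<Rightarrow> complex^'m \<Rightarrow> complex^'m" where
  "center_vec \<rho> a =
     (range_mat \<rho> ** (mat 1 - (1 / real CARD('m)) *\<^sub>R outer_prod (vec 1) (vec 1))) *v a"

(* scalar_product is bilinear: it stands for x^T y, and x^H y is
   scalar_product (cnj_vec x) y. *)
definition S_set :: "complex^'m \<Rightarrow> real^'m \<Rightarrow> (real \<times> real) set" where
  "S_set a \<rho> =
     {((cmod (scalar_product (cnj_vec (center_vec \<rho> a)) \<theta>))\<^sup>2,
       (cmod (scalar_product (range_vec \<rho>) \<theta>))\<^sup>2) | \<theta>. \<forall>i. cmod (\<theta> $ i) = 1}"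

(* Both traces are real for Hermitian \<Phi>, so every feasible \<Phi> contributes a point. *)
definition T_set :: "complex^'m \<Rightarrow> real^'m \<Rightarrow> (real \<times> real) set" where
  "T_set a \<rho> =
     {(u, v). \<exists>\<Phi>. hermitian_psd \<Phi> \<and> (\<forall>i. \<Phi> $ i $ i = 1) \<and>
        complex_of_real u =
          trace (outer_prod (center_vec \<rho> a) (cnj_vec (center_vec \<rho> a)) ** \<Phi>) \<and>
        complex_of_real v = trace (outer_prod (range_vec \<rho>) (range_vec \<rho>) ** \<Phi>)}"

definition is_max :: "real set \<Rightarrow> real \<Rightarrow> bool" where
  "is_max A M \<longleftrightarrow> M \<in> A \<and> (\<forall>x\<in>A. x \<le> M)"

(* Empty if the maximum is not attained, which cannot happen for compact nonempty K. *)
definition supporting_line :: "(real \<times> real) set \<Rightarrow> real \<Rightarrow> (real \<times> real) set" where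
  "supporting_line K \<beta> =
     {w. is_max ((\<lambda>w'. (cos \<beta>, sin \<beta>) \<bullet> w') ` K) ((cos \<beta>, sin \<beta>) \<bullet> w)}"

definition nonneg_supporting_lines :: "(real \<times> real) set \<Rightarrow> (real \<times> real) set set" where
  "nonneg_supporting_lines K = supporting_line K ` {0..pi/2}"

definition relevant_boundary :: "(real \<times> real) set \<Rightarrow> (real \<times> real) set" where
  "relevant_boundary K = K \<inter> \<Union> (nonneg_supporting_lines K)"

end

theory Submission
  imports Defs
begin

text \<open>
  For at most three anchors the two sets are tied much more closely than the theorem asks:
  \<open>T\<close> is exactly the convex hull of \<open>S\<close>. A linear functional has the same maximum over a
  compact set and over its convex hull, and a supporting line depends on the set only through
  such a maximum, so all three claims follow from this equality.

  The map \<open>\<Phi> \<mapsto> (c\<^sup>H \<Phi> c, r\<^sup>T \<Phi> r)\<close> is real linear. It sends the elliptope, i.e. the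
  positive semidefinite matrices with unit diagonal, onto \<open>T\<close>, and the rank-one matrices
  \<open>\<theta> \<theta>\<^sup>H\<close> with unimodular \<open>\<theta>\<close> onto \<open>S\<close>. Hence it is enough that the elliptope is the convex
  hull of these rank-one matrices (\<open>elliptope_eq_convex_hull_rank_one\<close>).

  The elliptope is compact and convex, so by the theorem of Krein and Milman it is the convex hull
  of its extreme points, and it remains to see that these have rank one. This is a dimension
  count. If the range of \<open>\<Phi>\<close> contains two independent vectors \<open>x\<close> and \<open>y\<close>, the Hermitian
  matrices with range in their span form a real space of dimension four. Vanishing of the
  diagonal imposes only \<open>m \<le> 3\<close> real linear conditions, so some nonzero \<open>H\<close> in this space has
  zero diagonal. Because the range of \<open>H\<close> lies in that of \<open>\<Phi>\<close>, the Cauchy-Schwarz inequality for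
  the form of \<open>\<Phi>\<close> bounds the form of \<open>H\<close> by a multiple of that of \<open>\<Phi>\<close>
  (\<open>hermitian_comb_bound\<close>). So \<open>\<Phi> + \<epsilon> H\<close> and \<open>\<Phi> - \<epsilon> H\<close> both lie in the elliptope for small
  \<open>\<epsilon>\<close>, and \<open>\<Phi>\<close>, being their midpoint, is not extreme.
\<close>

section \<open>The sesquilinear form of a matrix\<close>

definition sesq :: "complex^'m^'m \<Rightarrow> complex^'m \<Rightarrow> complex^'m \<Rightarrow> complex" where
  "sesq A x y = scalar_product (cnj_vec x) (A *v y)"

lemma sesq_eq_sum: "sesq A x y = (\<Sum>i\<in>UNIV. \<Sum>j\<in>UNIV. cnj (x $ i) * A $ i $ j * y $ j)"
  by (simp add: sesq_def scalar_product_def cnj_vec_def matrix_vector_mult_def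
      sum_distrib_left mult.assoc)

lemma sesq_add_left: "sesq A (x + y) z = sesq A x z + sesq A y z"
  by (simp add: sesq_eq_sum algebra_simps sum.distrib)

lemma sesq_add_right: "sesq A x (y + z) = sesq A x y + sesq A x z"
  by (simp add: sesq_eq_sum algebra_simps sum.distrib)

lemma sesq_scale_left: "sesq A (s *s x) z = cnj s * sesq A x z"
  by (simp add: sesq_eq_sum algebra_simps sum_distrib_left)

lemma sesq_scale_right: "sesq A x (s *s z) = s * sesq A x z"
  by (simp add: sesq_eq_sum algebra_simps sum_distrib_left)

lemma sesq_add_matrix: "sesq (A + B) x y = sesq A x y + sesq B x y"
  by (simp add: sesq_eq_sum algebra_simps sum.distrib)

lemma sesq_scaleR_matrix: "sesq (s *\<^sub>R A) x y = s *\<^sub>R sesq A x y"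
  by (simp add: sesq_eq_sum algebra_simps scaleR_sum_right)

lemma matrix_vector_mult_axis: "(A *v axis k (1::'a::semiring_1)) $ i = A $ i $ k"
proof -
  have "A $ i $ j * axis k 1 $ j = (if j = k then A $ i $ j else 0)" for j
    by (simp add: axis_def)
  then show ?thesis by (simp add: matrix_vector_mult_def)
qed

lemma sesq_axis: "sesq A (axis k 1) (axis l 1) = A $ k $ l"
proof -
  have "cnj (axis k 1 $ i) * (A *v axis l 1) $ i
      = (if i = k then (A *v axis l 1) $ i else 0)" for i
    by (simp add: axis_def)
  then show ?thesis
    by (simp add: sesq_def scalar_product_def cnj_vec_def matrix_vector_mult_axis)
qed

lemma sesq_outer_prod:
  "sesq (outer_prod u (cnj_vec w)) x y
    = scalar_product (cnj_vec x) u * scalar_product (cnj_vec w) y"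
  by (simp add: sesq_eq_sum outer_prod_def scalar_product_def cnj_vec_def sum_product mult.assoc)

lemma scalar_product_cnj_vec_commute:
  "scalar_product (cnj_vec x) y = cnj (scalar_product (cnj_vec y) x)"
  by (simp add: scalar_product_def cnj_vec_def mult.commute)

lemma trace_outer_prod_mult: "trace (outer_prod c (cnj_vec c) ** A) = sesq A c c"
proof -
  have "trace (outer_prod c (cnj_vec c) ** A)
      = (\<Sum>i\<in>UNIV. \<Sum>j\<in>UNIV. cnj (c $ j) * A $ j $ i * c $ i)"
    by (simp add: trace_def matrix_matrix_mult_def outer_prod_def cnj_vec_def mult_ac)
  also have "\<dots> = sesq A c c"
    unfolding sesq_eq_sum by (rule sum.swap)
  finally show ?thesis .
qed

section \<open>Positive semidefinite Hermitian matrices\<close>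

lemma hermitian_psd_alt:
  "hermitian_psd A \<longleftrightarrow> (\<forall>i j. cnj (A $ i $ j) = A $ j $ i) \<and> (\<forall>x. 0 \<le> Re (sesq A x x))"
proof -
  have "map_matrix cnj (transpose A) = A \<longleftrightarrow> (\<forall>i j. cnj (A $ i $ j) = A $ j $ i)"
    by (auto simp: vec_eq_iff transpose_def)
  then show ?thesis by (simp add: hermitian_psd_def sesq_def)
qed

lemma psd_sesq_cnj:
  assumes "hermitian_psd A"
  shows "cnj (sesq A x y) = sesq A y x"
proof -
  have "cnj (sesq A x y) = (\<Sum>i\<in>UNIV. \<Sum>j\<in>UNIV. cnj (y $ j) * A $ j $ i * x $ i)"
    using assms by (simp add: sesq_eq_sum hermitian_psd_alt mult_ac)
  also have "\<dots> = sesq A y x"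
    unfolding sesq_eq_sum by (rule sum.swap)
  finally show ?thesis .
qed

lemma psd_sesq_real:
  assumes "hermitian_psd A"
  shows "complex_of_real (Re (sesq A x x)) = sesq A x x"
  using psd_sesq_cnj[OF assms, of x x] by (metis Reals_cnj_iff of_real_Re)

lemma psd_sesq_nonneg: "hermitian_psd A \<Longrightarrow> 0 \<le> Re (sesq A x x)"
  by (simp add: hermitian_psd_alt)

text \<open>
  The form is only semidefinite, so \<open>y\<close> may be isotropic. Nonnegativity at \<open>x + t b\<^sup>* y\<close> for all
  real \<open>t\<close>, where \<open>b\<close> is the value of the form at \<open>(x, y)\<close>, settles both cases: the multiplier
  \<open>b\<^sup>*\<close> turns the cross terms into \<open>2 t \<bar>b\<bar>\<^sup>2\<close>.
\<close>

lemma psd_Cauchy_Schwarz: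
  assumes "hermitian_psd A"
  shows "(cmod (sesq A x y))\<^sup>2 \<le> Re (sesq A x x) * Re (sesq A y y)"
proof -
  define b where "b = sesq A x y"
  define X where "X = Re (sesq A x x)"
  define Y where "Y = Re (sesq A y y)"
  have XY: "0 \<le> X" "0 \<le> Y"
    using assms by (auto simp: X_def Y_def psd_sesq_nonneg)
  have poly: "0 \<le> X + 2 * t * (cmod b)\<^sup>2 + t\<^sup>2 * (cmod b)\<^sup>2 * Y" for t :: real
  proof -
    define s where "s = of_real t * cnj b"
    have "sesq A (x + s *s y) (x + s *s y)
        = sesq A x x + s * b + cnj (s * b) + (cnj s * s) * sesq A y y"
      using psd_sesq_cnj[OF assms, of x y]
      by (simp add: sesq_add_left sesq_add_right sesq_scale_left sesq_scale_right b_def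
          algebra_simps)
    moreover have "s * b = of_real (t * (cmod b)\<^sup>2)"
      unfolding s_def of_real_mult complex_norm_square by simp
    moreover have "cnj s * s = of_real (t\<^sup>2 * (cmod b)\<^sup>2)"
      unfolding s_def of_real_mult complex_norm_square by (simp add: power2_eq_square)
    ultimately have "Re (sesq A (x + s *s y) (x + s *s y))
        = X + 2 * t * (cmod b)\<^sup>2 + t\<^sup>2 * (cmod b)\<^sup>2 * Y"
      by (simp add: X_def Y_def)
    then show ?thesis
      using psd_sesq_nonneg[OF assms, of "x + s *s y"] by simp
  qed
  show ?thesis
  proof (cases "Y = 0")
    case True
    \<comment> \<open>The quadratic in \<open>t\<close> degenerates to an affine function, which has a negative value
      unless its slope vanishes.\<close>
    have "cmod b = 0"
    proof (rule ccontr)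
      assume "cmod b \<noteq> 0"
      with poly[of "- (X + 1) / (cmod b)\<^sup>2"] True XY show False
        by simp
    qed
    then show ?thesis
      using XY by (simp add: b_def X_def Y_def)
  next
    case False
    \<comment> \<open>The value \<open>t = - 1 / Y\<close> minimizes the quadratic.\<close>
    with poly[of "- 1 / Y"] XY have "0 \<le> X - (cmod b)\<^sup>2 / Y"
      by (simp add: power2_eq_square)
    with False XY have "(cmod b)\<^sup>2 \<le> X * Y"
      by (simp add: field_simps)
    then show ?thesis by (simp add: b_def X_def Y_def)
  qed
qed

section \<open>The complex elliptope\<close>

definition elliptope :: "(complex^'m^'m) set" where
  "elliptope = {\<Phi>. hermitian_psd \<Phi> \<and> (\<forall>i. \<Phi> $ i $ i = 1)}"

definition unimodular :: "(complex^'m) set" where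
  "unimodular = {\<theta>. \<forall>i. cmod (\<theta> $ i) = 1}"

lemma outer_prod_unimodular_in_elliptope:
  assumes "\<theta> \<in> unimodular"
  shows "outer_prod \<theta> (cnj_vec \<theta>) \<in> elliptope"
proof -
  have "\<theta> $ i * cnj (\<theta> $ i) = 1" for i
    using assms by (simp add: unimodular_def complex_norm_square[symmetric])
  moreover have "0 \<le> Re (sesq (outer_prod \<theta> (cnj_vec \<theta>)) x x)" for x
    unfolding sesq_outer_prod scalar_product_cnj_vec_commute[of x] by simp
  ultimately show ?thesis
    by (simp add: elliptope_def hermitian_psd_alt outer_prod_def cnj_vec_def mult.commute)
qed

lemma convex_elliptope: "convex elliptope"
proof (rule convexI)
  fix A B :: "complex^'m^'m" and u v :: real
  assume A: "A \<in> elliptope" and B: "B \<in> elliptope" and uv: "0 \<le> u" "0 \<le> v" "u + v = 1"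
  have "complex_of_real u + of_real v = 1"
    using uv(3) by (metis of_real_1 of_real_add)
  then have "u *\<^sub>R (1::complex) + v *\<^sub>R 1 = 1"
    by (simp add: scaleR_conv_of_real)
  moreover have "0 \<le> Re (sesq (u *\<^sub>R A + v *\<^sub>R B) x x)" for x
    using A B uv by (simp add: sesq_add_matrix sesq_scaleR_matrix elliptope_def psd_sesq_nonneg)
  moreover have "cnj ((u *\<^sub>R A + v *\<^sub>R B) $ i $ j) = (u *\<^sub>R A + v *\<^sub>R B) $ j $ i" for i j
    using A B by (simp add: elliptope_def hermitian_psd_alt)
  ultimately show "u *\<^sub>R A + v *\<^sub>R B \<in> elliptope"
    using A B by (simp add: elliptope_def hermitian_psd_alt)
qed

text \<open>Cauchy-Schwarz for two unit vectors bounds an entry by the diagonal.\<close>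

lemma elliptope_entry_le_1:
  assumes "\<Phi> \<in> elliptope"
  shows "cmod (\<Phi> $ i $ j) \<le> 1"
  using psd_Cauchy_Schwarz[of \<Phi> "axis i 1" "axis j 1"] assms
  by (simp add: elliptope_def sesq_axis power_le_one_iff)

lemma compact_elliptope: "compact (elliptope :: (complex^'m^'m) set)"
proof -
  have "norm \<Phi> \<le> (\<Sum>i\<in>(UNIV::'m set). \<Sum>j\<in>(UNIV::'m set). 1)" if "\<Phi> \<in> elliptope" for \<Phi> :: "complex^'m^'m"
  proof -
    have "norm \<Phi> \<le> (\<Sum>i\<in>UNIV. norm (\<Phi> $ i))"
      by (simp add: norm_vec_def L2_set_le_sum)
    also have "\<dots> \<le> (\<Sum>i\<in>(UNIV::'m set). \<Sum>j\<in>UNIV. cmod (\<Phi> $ i $ j))"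
      by (intro sum_mono) (simp add: norm_vec_def L2_set_le_sum)
    also have "\<dots> \<le> (\<Sum>i\<in>(UNIV::'m set). \<Sum>j\<in>(UNIV::'m set). 1)"
      by (intro sum_mono elliptope_entry_le_1 that)
    finally show ?thesis .
  qed
  then have "bounded (elliptope :: (complex^'m^'m) set)"
    unfolding bounded_iff by blast
  moreover have "closed (elliptope :: (complex^'m^'m) set)"
    unfolding elliptope_def hermitian_psd_alt sesq_eq_sum
    by (intro closed_Collect_conj closed_Collect_all closed_Collect_eq closed_Collect_le
        continuous_intros)
  ultimately show ?thesis by (simp add: compact_eq_bounded_closed)
qed

section \<open>Extreme points of a small elliptope\<close>

lemma elliptope_add_perturbation:
  assumes \<Phi>: "\<Phi> \<in> elliptope"
    and herm: "\<And>i j. cnj (H $ i $ j) = H $ j $ i"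
    and diag: "\<And>i. H $ i $ i = 0"
    and bound: "\<And>z. \<bar>Re (sesq H z z)\<bar> \<le> K * Re (sesq \<Phi> z z)"
    and \<epsilon>: "\<bar>\<epsilon>\<bar> * K \<le> 1"
  shows "\<Phi> + \<epsilon> *\<^sub>R H \<in> elliptope"
proof -
  have "0 \<le> Re (sesq (\<Phi> + \<epsilon> *\<^sub>R H) z z)" for z
  proof -
    have "\<bar>\<epsilon> * Re (sesq H z z)\<bar> \<le> \<bar>\<epsilon>\<bar> * (K * Re (sesq \<Phi> z z))"
      unfolding abs_mult by (intro mult_left_mono bound) simp
    also have "\<dots> = (\<bar>\<epsilon>\<bar> * K) * Re (sesq \<Phi> z z)" by simp
    also have "\<dots> \<le> 1 * Re (sesq \<Phi> z z)"
      using \<Phi> by (intro mult_right_mono \<epsilon>) (simp add: elliptope_def psd_sesq_nonneg)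
    finally show ?thesis
      by (simp add: sesq_add_matrix sesq_scaleR_matrix)
  qed
  moreover have "cnj ((\<Phi> + \<epsilon> *\<^sub>R H) $ i $ j) = (\<Phi> + \<epsilon> *\<^sub>R H) $ j $ i" for i j
    using \<Phi> herm by (simp add: elliptope_def hermitian_psd_alt)
  ultimately show ?thesis
    using \<Phi> diag by (simp add: elliptope_def hermitian_psd_alt)
qed

text \<open>
  A Hermitian direction with zero diagonal whose form is dominated by that of \<open>\<Phi>\<close> can be followed
  a little way both forwards and backwards without leaving the elliptope.
\<close>

lemma extreme_elliptope_no_perturbation:
  assumes ext: "\<Phi> extreme_point_of elliptope"
    and herm: "\<And>i j. cnj (H $ i $ j) = H $ j $ i"
    and diag: "\<And>i. H $ i $ i = 0"
    and bound: "\<And>z. \<bar>Re (sesq H z z)\<bar> \<le> K * Re (sesq \<Phi> z z)"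
  shows "H = 0"
proof (rule ccontr)
  assume "H \<noteq> 0"
  \<comment> \<open>The summand 1 keeps the step size positive when \<open>K = 0\<close>.\<close>
  define \<epsilon> where "\<epsilon> = 1 / (\<bar>K\<bar> + 1)"
  have \<epsilon>: "0 < \<epsilon>" "\<epsilon> * K \<le> 1"
    by (auto simp: \<epsilon>_def field_simps)
  have \<Phi>: "\<Phi> \<in> elliptope"
    using ext by (simp add: extreme_point_of_def)
  have plus: "\<Phi> + \<epsilon> *\<^sub>R H \<in> elliptope"
    using \<epsilon> by (intro elliptope_add_perturbation[OF \<Phi> herm diag bound]) simp
  have minus: "\<Phi> + (- \<epsilon>) *\<^sub>R H \<in> elliptope"
    using \<epsilon> by (intro elliptope_add_perturbation[OF \<Phi> herm diag bound]) simp
  have "midpoint (\<Phi> + \<epsilon> *\<^sub>R H) (\<Phi> + (- \<epsilon>) *\<^sub>R H) = \<Phi>"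
    by (simp add: midpoint_def scaleR_2[symmetric])
  moreover have "\<Phi> + \<epsilon> *\<^sub>R H \<noteq> \<Phi> + (- \<epsilon>) *\<^sub>R H"
  proof
    assume "\<Phi> + \<epsilon> *\<^sub>R H = \<Phi> + (- \<epsilon>) *\<^sub>R H"
    then have "(2 * \<epsilon>) *\<^sub>R H = 0"
      by (simp add: scaleR_2[symmetric] eq_neg_iff_add_eq_0)
    with \<open>H \<noteq> 0\<close> \<epsilon> show False by simp
  qed
  ultimately have "\<Phi> \<in> open_segment (\<Phi> + \<epsilon> *\<^sub>R H) (\<Phi> + (- \<epsilon>) *\<^sub>R H)"
    by (metis midpoint_in_open_segment)
  with ext plus minus show False
    by (auto simp: extreme_point_of_def)
qed

text \<open>
  These are the matrices \<open>\<alpha> x x\<^sup>H + \<beta> y y\<^sup>H + \<gamma> x y\<^sup>H + \<gamma>\<^sup>* y x\<^sup>H\<close>, i.e. \<open>V B V\<^sup>H\<close> for the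
  two-column matrix \<open>V = (x y)\<close> and an arbitrary Hermitian \<open>2 \<times> 2\<close> matrix \<open>B\<close>. The parameters
  are tupled so that they form a Euclidean space of dimension four.
\<close>

definition hermitian_comb ::
  "complex^'m \<Rightarrow> complex^'m \<Rightarrow> real \<times> real \<times> complex \<Rightarrow> complex^'m^'m" where
  "hermitian_comb x y = (\<lambda>(\<alpha>, \<beta>, \<gamma>).
     \<chi> i j. \<alpha> *\<^sub>R (x $ i * cnj (x $ j)) + \<beta> *\<^sub>R (y $ i * cnj (y $ j))
         + \<gamma> * x $ i * cnj (y $ j) + cnj \<gamma> * y $ i * cnj (x $ j))"

lemma hermitian_comb_cnj: "cnj (hermitian_comb x y p $ i $ j) = hermitian_comb x y p $ j $ i"
  by (cases p) (simp add: hermitian_comb_def mult_ac)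

lemma Re_sesq_hermitian_comb:
  "Re (sesq (hermitian_comb x y (\<alpha>, \<beta>, \<gamma>)) z z)
    = \<alpha> * (cmod (scalar_product (cnj_vec z) x))\<^sup>2 + \<beta> * (cmod (scalar_product (cnj_vec z) y))\<^sup>2
      + 2 * Re (\<gamma> * scalar_product (cnj_vec z) x * cnj (scalar_product (cnj_vec z) y))"
proof -
  have "sesq (hermitian_comb x y (\<alpha>, \<beta>, \<gamma>)) z z
      = \<alpha> *\<^sub>R sesq (outer_prod x (cnj_vec x)) z z + \<beta> *\<^sub>R sesq (outer_prod y (cnj_vec y)) z z
        + \<gamma> * sesq (outer_prod x (cnj_vec y)) z z + cnj \<gamma> * sesq (outer_prod y (cnj_vec x)) z z"
    unfolding sesq_eq_sum hermitian_comb_def outer_prod_def cnj_vec_def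
    by (simp add: scaleR_conv_of_real sum_distrib_left sum.distrib algebra_simps)
  then show ?thesis
    unfolding sesq_outer_prod scalar_product_cnj_vec_commute[of x z]
      scalar_product_cnj_vec_commute[of y z]
    by (simp add: complex_norm_square[symmetric] algebra_simps flip: cmod_power2)
qed

text \<open>
  Diagonal entries of a Hermitian matrix are real, so the diagonal is a linear map from a space of
  real dimension four to one of dimension at most three.
\<close>

lemma hermitian_comb_zero_diagonal:
  fixes x y :: "complex^'m"
  assumes "CARD('m) < 4"
  obtains p where "p \<noteq> 0" and "\<And>i. hermitian_comb x y p $ i $ i = 0"
proof -
  define L :: "real \<times> real \<times> complex \<Rightarrow> real^'m" where
    "L p = (\<chi> i. Re (hermitian_comb x y p $ i $ i))" for p
  have lin: "linear L"
    by (rule linearI) (auto simp: L_def hermitian_comb_def vec_eq_iff algebra_simps)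
  have "\<not> inj L"
  proof
    assume "inj L"
    then have "dim (L ` UNIV) = dim (UNIV :: (real \<times> real \<times> complex) set)"
      using lin by (intro dim_image_eq) auto
    moreover have "dim (L ` UNIV) \<le> CARD('m)"
      using dim_subset_UNIV[of "L ` UNIV"] by simp
    ultimately show False using assms by simp
  qed
  then obtain p where "p \<noteq> 0" "L p = 0"
    using linear_injective_0[OF lin] by blast
  moreover have "hermitian_comb x y p $ i $ i = 0" for i
    using \<open>L p = 0\<close> hermitian_comb_cnj[of x y p i i]
    by (auto simp: L_def vec_eq_iff complex_eq_iff)
  ultimately show ?thesis using that by blast
qed

text \<open>
  The form of the combination at \<open>z\<close> is a quadratic polynomial in \<open>X = z\<^sup>H \<Phi> p\<close> and
  \<open>Y = z\<^sup>H \<Phi> q\<close>. Cauchy-Schwarz for \<open>\<Phi>\<close> bounds \<open>\<bar>X\<bar>\<^sup>2\<close> and \<open>\<bar>Y\<bar>\<^sup>2\<close> by multiples of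
  \<open>z\<^sup>H \<Phi> z\<close>; this is where it matters that both vectors lie in the range of \<open>\<Phi>\<close>.
\<close>

lemma hermitian_comb_bound:
  assumes "hermitian_psd \<Phi>"
  shows "\<exists>K. \<forall>z. \<bar>Re (sesq (hermitian_comb (\<Phi> *v p) (\<Phi> *v q) (\<alpha>, \<beta>, \<gamma>)) z z)\<bar>
            \<le> K * Re (sesq \<Phi> z z)"
proof -
  define P where "P = Re (sesq \<Phi> p p)"
  define Q where "Q = Re (sesq \<Phi> q q)"
  define K where "K = \<bar>\<alpha>\<bar> * P + \<bar>\<beta>\<bar> * Q + cmod \<gamma> * (P + Q)"
  have "\<bar>Re (sesq (hermitian_comb (\<Phi> *v p) (\<Phi> *v q) (\<alpha>, \<beta>, \<gamma>)) z z)\<bar> \<le> K * Re (sesq \<Phi> z z)" for z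
  proof -
    define Z where "Z = Re (sesq \<Phi> z z)"
    define X where "X = sesq \<Phi> z p"
    define Y where "Y = sesq \<Phi> z q"
    have X: "(cmod X)\<^sup>2 \<le> P * Z" and Y: "(cmod Y)\<^sup>2 \<le> Q * Z"
      using psd_Cauchy_Schwarz[OF assms, of z p] psd_Cauchy_Schwarz[OF assms, of z q]
      by (simp_all add: X_def Y_def P_def Q_def Z_def mult.commute)
    have "2 * (cmod X * cmod Y) \<le> (cmod X)\<^sup>2 + (cmod Y)\<^sup>2"
      using sum_squares_bound[of "cmod X" "cmod Y"] by simp
    also have "\<dots> \<le> (P + Q) * Z"
      using X Y by (simp add: algebra_simps)
    finally have XY: "2 * (cmod X * cmod Y) \<le> (P + Q) * Z" .
    have "\<bar>2 * Re (\<gamma> * X * cnj Y)\<bar> \<le> 2 * cmod (\<gamma> * X * cnj Y)"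
      using abs_Re_le_cmod[of "\<gamma> * X * cnj Y"] by linarith
    also have "\<dots> = cmod \<gamma> * (2 * (cmod X * cmod Y))"
      by (simp add: norm_mult)
    also have "\<dots> \<le> cmod \<gamma> * ((P + Q) * Z)"
      using XY by (rule mult_left_mono) simp
    finally have 3: "\<bar>2 * Re (\<gamma> * X * cnj Y)\<bar> \<le> cmod \<gamma> * ((P + Q) * Z)" .
    have 1: "\<bar>\<alpha> * (cmod X)\<^sup>2\<bar> \<le> \<bar>\<alpha>\<bar> * (P * Z)"
      using X by (simp add: abs_mult mult_left_mono)
    have 2: "\<bar>\<beta> * (cmod Y)\<^sup>2\<bar> \<le> \<bar>\<beta>\<bar> * (Q * Z)"
      using Y by (simp add: abs_mult mult_left_mono)
    have "\<bar>\<alpha> * (cmod X)\<^sup>2 + \<beta> * (cmod Y)\<^sup>2 + 2 * Re (\<gamma> * X * cnj Y)\<bar>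
        \<le> \<bar>\<alpha>\<bar> * (P * Z) + \<bar>\<beta>\<bar> * (Q * Z) + cmod \<gamma> * ((P + Q) * Z)"
      using 1 2 3 by linarith
    also have "\<dots> = K * Z"
      by (simp add: K_def algebra_simps)
    finally show ?thesis
      by (simp add: Re_sesq_hermitian_comb X_def Y_def Z_def sesq_def[of \<Phi> z p]
          sesq_def[of \<Phi> z q])
  qed
  then show ?thesis by blast
qed

text \<open>
  The identity says that column \<open>j\<close> is the multiple of column \<open>k\<close> by the scalar \<open>\<Phi>\<^sub>k\<^sub>j\<close>. If it
  fails, the columns are independent, and the difference of the two sides gives a vector \<open>y\<close> in
  the range of \<open>\<Phi>\<close> whose entry \<open>k\<close> vanishes, while entry \<open>k\<close> of column \<open>k\<close> is 1. With this
  normalization the coefficients of a vanishing combination can be read off one at a time.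
\<close>

lemma extreme_elliptope_multiplicative:
  fixes \<Phi> :: "complex^'m^'m"
  assumes card: "CARD('m) < 4" and ext: "\<Phi> extreme_point_of elliptope"
  shows "\<Phi> $ i $ j = \<Phi> $ i $ k * \<Phi> $ k $ j"
proof (rule ccontr)
  assume neq: "\<Phi> $ i $ j \<noteq> \<Phi> $ i $ k * \<Phi> $ k $ j"
  have \<Phi>: "hermitian_psd \<Phi>" "\<Phi> $ k $ k = 1"
    using ext by (auto simp: extreme_point_of_def elliptope_def)
  define p :: "complex^'m" where "p = axis k 1"
  define q :: "complex^'m" where "q = axis j 1 - (\<Phi> $ k $ j) *s axis k 1"
  define x where "x = \<Phi> *v p"
  define y where "y = \<Phi> *v q"
  have x: "x $ l = \<Phi> $ l $ k" for l
    by (simp add: x_def p_def matrix_vector_mult_axis)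
  have y: "y $ l = \<Phi> $ l $ j - \<Phi> $ l $ k * \<Phi> $ k $ j" for l
    by (simp add: y_def q_def matrix_vector_mult_diff_distrib vector_scalar_commute
        matrix_vector_mult_axis mult.commute)
  obtain \<alpha> \<beta> \<gamma> where nz: "(\<alpha>, \<beta>, \<gamma>) \<noteq> (0 :: real \<times> real \<times> complex)"
    and diag: "\<And>l. hermitian_comb x y (\<alpha>, \<beta>, \<gamma>) $ l $ l = 0"
    using hermitian_comb_zero_diagonal[OF card, of x y] by (metis prod_cases3)
  obtain K where K: "\<And>z. \<bar>Re (sesq (hermitian_comb x y (\<alpha>, \<beta>, \<gamma>)) z z)\<bar> \<le> K * Re (sesq \<Phi> z z)"
    using hermitian_comb_bound[OF \<Phi>(1), of p q \<alpha> \<beta> \<gamma>] unfolding x_def y_def by blast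
  have H0: "hermitian_comb x y (\<alpha>, \<beta>, \<gamma>) = 0"
    using ext hermitian_comb_cnj diag K by (rule extreme_elliptope_no_perturbation)
  have xk: "x $ k = 1" and yk: "y $ k = 0" and yi: "y $ i \<noteq> 0"
    using neq \<Phi>(2) by (auto simp: x y)
  have entry: "\<alpha> *\<^sub>R (x $ s * cnj (x $ t)) + \<beta> *\<^sub>R (y $ s * cnj (y $ t))
         + \<gamma> * x $ s * cnj (y $ t) + cnj \<gamma> * y $ s * cnj (x $ t) = 0" for s t
    using arg_cong[OF H0, of "\<lambda>A. A $ s $ t"] by (simp add: hermitian_comb_def)
  have "\<alpha> = 0"
    using entry[of k k] xk yk by simp
  moreover have "\<gamma> = 0"
    using entry[of i k] xk yk yi \<open>\<alpha> = 0\<close> by simp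
  moreover have "\<beta> = 0"
    using entry[of i i] yi \<open>\<alpha> = 0\<close> \<open>\<gamma> = 0\<close> by simp
  ultimately show False
    using nz by (simp add: zero_prod_def)
qed

lemma extreme_elliptope_rank_one:
  fixes \<Phi> :: "complex^'m^'m"
  assumes card: "CARD('m) < 4" and ext: "\<Phi> extreme_point_of elliptope"
  shows "\<exists>\<theta>\<in>unimodular. \<Phi> = outer_prod \<theta> (cnj_vec \<theta>)"
proof -
  have \<Phi>: "hermitian_psd \<Phi>" "\<And>i. \<Phi> $ i $ i = 1"
    using ext by (auto simp: extreme_point_of_def elliptope_def)
  have prod: "\<Phi> $ i $ j = \<Phi> $ i $ k * cnj (\<Phi> $ j $ k)" for i j k
    using extreme_elliptope_multiplicative[OF card ext, of i j k] \<Phi>(1)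
    by (metis hermitian_psd_alt)
  \<comment> \<open>All columns agree up to a unimodular factor, so any of them can serve.\<close>
  define \<theta> :: "complex^'m" where "\<theta> = column undefined \<Phi>"
  have "cmod (\<theta> $ i) = 1" for i
  proof -
    have "complex_of_real ((cmod (\<theta> $ i))\<^sup>2) = 1"
      using prod[of i i undefined] \<Phi>(2)[of i]
      by (simp add: \<theta>_def column_def complex_norm_square[symmetric])
    then have "(cmod (\<theta> $ i))\<^sup>2 = 1"
      using of_real_eq_1_iff by blast
    then show ?thesis
      using norm_ge_zero[of "\<theta> $ i"] by (auto simp: power2_eq_1_iff)
  qed
  moreover have "\<Phi> = outer_prod \<theta> (cnj_vec \<theta>)"
    by (simp add: vec_eq_iff outer_prod_def cnj_vec_def \<theta>_def column_def prod[symmetric])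
  ultimately show ?thesis by (auto simp: unimodular_def)
qed

text \<open>
  The bound on the dimension is sharp: an extreme point of rank \<open>k\<close> exists only if \<open>k\<^sup>2 \<le> m\<close>, and
  for \<open>m = 4\<close> there are extreme points of rank two.
\<close>

theorem elliptope_eq_convex_hull_rank_one:
  assumes card: "CARD('m) < 4"
  shows "(elliptope :: (complex^'m^'m) set)
    = convex hull ((\<lambda>\<theta>. outer_prod \<theta> (cnj_vec \<theta>)) ` unimodular)"
proof
  have "elliptope = convex hull {\<Phi> :: complex^'m^'m. \<Phi> extreme_point_of elliptope}"
    by (rule Krein_Milman_Minkowski[OF compact_elliptope convex_elliptope])
  also have "\<dots> \<subseteq> convex hull ((\<lambda>\<theta>. outer_prod \<theta> (cnj_vec \<theta>)) ` unimodular)"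
    using extreme_elliptope_rank_one[OF card] by (intro hull_mono) blast
  finally show "(elliptope :: (complex^'m^'m) set)
      \<subseteq> convex hull ((\<lambda>\<theta>. outer_prod \<theta> (cnj_vec \<theta>)) ` unimodular)" .
  show "convex hull ((\<lambda>\<theta>. outer_prod \<theta> (cnj_vec \<theta>)) ` unimodular)
      \<subseteq> (elliptope :: (complex^'m^'m) set)"
    by (intro hull_minimal convex_elliptope) (auto intro: outer_prod_unimodular_in_elliptope)
qed

section \<open>The sets of the localization problem\<close>

definition form_pair :: "complex^'m \<Rightarrow> complex^'m \<Rightarrow> complex^'m^'m \<Rightarrow> real \<times> real" where
  "form_pair c d A = (Re (sesq A c c), Re (sesq A d d))"

lemma linear_form_pair: "linear (form_pair c d)"
  by (rule linearI) (simp_all add: form_pair_def sesq_add_matrix sesq_scaleR_matrix)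

lemma cnj_vec_range_vec: "cnj_vec (range_vec \<rho>) = range_vec \<rho>"
proof -
  have "range_vec \<rho> $ i = of_real (\<rho> $ i)" for i
    by (simp add: range_vec_def range_mat_def matrix_vector_mult_def
        if_distrib[of "\<lambda>x. x * _"] cong: if_cong)
  then show ?thesis by (simp add: cnj_vec_def vec_eq_iff)
qed

text \<open>
  A point of \<open>T\<close> is given by complex equations; taking real parts loses nothing because the form of
  a Hermitian matrix is real when its two arguments coincide.
\<close>

lemma T_set_eq_image: "T_set a \<rho> = form_pair (center_vec \<rho> a) (range_vec \<rho>) ` elliptope"
proof -
  have tr: "trace (outer_prod (range_vec \<rho>) (range_vec \<rho>) ** \<Phi>) = sesq \<Phi> (range_vec \<rho>) (range_vec \<rho>)"
    for \<Phi>
    using trace_outer_prod_mult[of "range_vec \<rho>" \<Phi>] by (simp add: cnj_vec_range_vec)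
  show ?thesis
    unfolding T_set_def tr trace_outer_prod_mult
  proof (intro set_eqI iffI; clarsimp simp: form_pair_def image_iff elliptope_def)
    fix u v \<Phi>
    assume "hermitian_psd \<Phi>" "\<forall>i. \<Phi> $ i $ i = 1"
      "complex_of_real u = sesq \<Phi> (center_vec \<rho> a) (center_vec \<rho> a)"
      "complex_of_real v = sesq \<Phi> (range_vec \<rho>) (range_vec \<rho>)"
    then show "\<exists>\<Phi>. hermitian_psd \<Phi> \<and> (\<forall>i. \<Phi> $ i $ i = 1)
        \<and> u = Re (sesq \<Phi> (center_vec \<rho> a) (center_vec \<rho> a))
        \<and> v = Re (sesq \<Phi> (range_vec \<rho>) (range_vec \<rho>))"
      by (metis Re_complex_of_real)
  next
    fix \<Phi> :: "complex^'a^'a"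
    assume "hermitian_psd \<Phi>" "\<forall>i. \<Phi> $ i $ i = 1"
    then show "\<exists>\<Phi>'. hermitian_psd \<Phi>' \<and> (\<forall>i. \<Phi>' $ i $ i = 1)
        \<and> complex_of_real (Re (sesq \<Phi> (center_vec \<rho> a) (center_vec \<rho> a)))
            = sesq \<Phi>' (center_vec \<rho> a) (center_vec \<rho> a)
        \<and> complex_of_real (Re (sesq \<Phi> (range_vec \<rho>) (range_vec \<rho>)))
            = sesq \<Phi>' (range_vec \<rho>) (range_vec \<rho>)"
      using psd_sesq_real by blast
  qed
qed

lemma S_set_eq_image_unimodular:
  "S_set a \<rho> = (\<lambda>\<theta>. ((cmod (scalar_product (cnj_vec (center_vec \<rho> a)) \<theta>))\<^sup>2,
       (cmod (scalar_product (range_vec \<rho>) \<theta>))\<^sup>2)) ` unimodular"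
  by (auto simp: S_set_def unimodular_def)

text \<open>Both coordinates are values of the form of the rank-one matrix \<open>\<theta> \<theta>\<^sup>H\<close>, since
  \<open>\<bar>c\<^sup>H \<theta>\<bar>\<^sup>2 = c\<^sup>H \<theta> \<theta>\<^sup>H c\<close>.\<close>

lemma S_set_eq_image:
  "S_set a \<rho> = form_pair (center_vec \<rho> a) (range_vec \<rho>)
     ` (\<lambda>\<theta>. outer_prod \<theta> (cnj_vec \<theta>)) ` unimodular"
proof -
  have "Re (sesq (outer_prod \<theta> (cnj_vec \<theta>)) c c) = (cmod (scalar_product (cnj_vec c) \<theta>))\<^sup>2"
    for \<theta> c :: "complex^'a"
    unfolding sesq_outer_prod scalar_product_cnj_vec_commute[of \<theta> c]
    by (simp add: complex_norm_square[symmetric] flip: cmod_power2)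
  then show ?thesis
    by (simp add: S_set_eq_image_unimodular form_pair_def image_image cnj_vec_range_vec)
qed

theorem T_set_eq_convex_hull_S_set:
  fixes a :: "complex^'m"
  assumes "CARD('m) < 4"
  shows "T_set a \<rho> = convex hull (S_set a \<rho>)"
  unfolding T_set_eq_image S_set_eq_image elliptope_eq_convex_hull_rank_one[OF assms]
  by (rule convex_hull_linear_image[OF linear_form_pair])

lemma compact_unimodular: "compact (unimodular :: (complex^'m) set)"
proof -
  have "norm \<theta> \<le> (\<Sum>i\<in>(UNIV::'m set). 1)" if "\<theta> \<in> unimodular" for \<theta> :: "complex^'m"
  proof -
    have "norm \<theta> \<le> (\<Sum>i\<in>UNIV. cmod (\<theta> $ i))"
      by (simp add: norm_vec_def L2_set_le_sum)
    with that show ?thesis by (simp add: unimodular_def)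
  qed
  then have "bounded (unimodular :: (complex^'m) set)"
    unfolding bounded_iff by blast
  moreover have "closed (unimodular :: (complex^'m) set)"
    unfolding unimodular_def
    by (intro closed_Collect_all closed_Collect_eq continuous_intros)
  ultimately show ?thesis by (simp add: compact_eq_bounded_closed)
qed

lemma compact_S_set: "compact (S_set a \<rho>)"
  unfolding S_set_eq_image_unimodular scalar_product_def
  by (intro compact_continuous_image compact_unimodular continuous_intros)

lemma S_set_nonempty: "S_set a \<rho> \<noteq> {}"
proof -
  have "vec 1 \<in> (unimodular :: (complex^'a) set)"
    by (simp add: unimodular_def)
  then show ?thesis
    unfolding S_set_eq_image by blast
qed

section \<open>Linear maxima over a convex hull\<close>

lemma is_max_unique: "is_max A M \<Longrightarrow> is_max A N \<Longrightarrow> M = N"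
  unfolding is_max_def by (meson order_antisym)

lemma is_max_convex_hull:
  fixes f :: "'a::real_vector \<Rightarrow> real"
  assumes lin: "linear f" and max: "is_max (f ` S) M"
  shows "is_max (f ` (convex hull S)) M"
proof -
  have "f ` (convex hull S) = convex hull (f ` S)"
    using lin by (rule convex_hull_linear_image)
  also have "\<dots> \<subseteq> {..M}"
    using max by (intro hull_minimal) (auto simp: is_max_def)
  finally show ?thesis
    using max hull_subset[of S convex] unfolding is_max_def by blast
qed

lemma compact_is_max:
  fixes f :: "'a::euclidean_space \<Rightarrow> real"
  assumes "compact S" "S \<noteq> {}" "linear f"
  shows "\<exists>M. is_max (f ` S) M"
proof -
  have "continuous_on S f"
    using assms(3) by (rule linear_continuous_on_compose[OF continuous_on_id])
  then show ?thesis
    using continuous_attains_sup[OF assms(1,2), of f] unfolding is_max_def by blast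
qed

lemma supporting_line_convex_hull:
  assumes "compact S" "S \<noteq> {}"
  shows "supporting_line (convex hull S) \<beta> = supporting_line S \<beta>"
proof -
  let ?f = "\<lambda>w. (cos \<beta>, sin \<beta>) \<bullet> (w :: real \<times> real)"
  have lin: "linear ?f"
    by (rule linearI) (simp_all add: inner_add_right)
  obtain M where "is_max (?f ` S) M"
    using compact_is_max[OF assms lin] by blast
  moreover from this have "is_max (?f ` (convex hull S)) M"
    by (rule is_max_convex_hull[OF lin])
  ultimately have "is_max (?f ` (convex hull S)) N \<longleftrightarrow> is_max (?f ` S) N" for N
    using is_max_unique by metis
  then show ?thesis by (simp add: supporting_line_def)
qed

text \<open>
  With \<open>T\<close> equal to the convex hull of \<open>S\<close>, the statement about relevant boundaries becomes trivial;
  compactness of \<open>S\<close> is what makes the maxima exist.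
\<close>

theorem lemma1:
  fixes a :: "complex^'m" and r :: "real^'m"
  assumes "CARD('m) \<in> {1, 2, 3}"
  shows "nonneg_supporting_lines (S_set a r) = nonneg_supporting_lines (T_set a r) \<and>
    (\<forall>\<beta>\<in>{0..pi/2}. \<exists>M.
        is_max ((\<lambda>(u, v). u * cos \<beta> + v * sin \<beta>) ` S_set a r) M \<and>
        is_max ((\<lambda>(u, v). u * cos \<beta> + v * sin \<beta>) ` T_set a r) M) \<and>
    relevant_boundary (T_set a r) = relevant_boundary (convex hull (S_set a r))"
proof -
  have "CARD('m) < 4"
    using assms by auto
  then have T: "T_set a r = convex hull (S_set a r)"
    by (rule T_set_eq_convex_hull_S_set)
  have "\<exists>M. is_max ((\<lambda>(u, v). u * cos \<beta> + v * sin \<beta>) ` S_set a r) M \<and>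
        is_max ((\<lambda>(u, v). u * cos \<beta> + v * sin \<beta>) ` T_set a r) M" for \<beta>
  proof -
    have lin: "linear (\<lambda>(u, v). u * cos \<beta> + v * sin \<beta>)"
      by (rule linearI) (auto simp: algebra_simps)
    show ?thesis
      unfolding T
      using compact_is_max[OF compact_S_set S_set_nonempty lin] is_max_convex_hull[OF lin] by blast
  qed
  moreover have "nonneg_supporting_lines (S_set a r) = nonneg_supporting_lines (T_set a r)"
    unfolding nonneg_supporting_lines_def T
    by (simp add: supporting_line_convex_hull[OF compact_S_set S_set_nonempty])
  ultimately show ?thesis
    unfolding T by blast
qed

end
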